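(* Let $C_1$ and $C_2$ be full-sized horoballs with disjoint interiors. Let $B_1$ and $B_2$ be tangent horoballs of Euclidean heights $h_1$ and $h_2$ respectively, with $h_i\le 1$ for $i=1,2$, whose interiors are disjoint from $C_1\cup C_2$. Let $L\subset\mathbb{R}^2$ be the line through $\mathrm{center}(C_1)$ and $\mathrm{center}(C_2)$, and for $i=1,2$ let $v_i\subset\mathbb{R}^2$ be the line orthogonal to $L$ through $\mathrm{center}(C_i)$ and $V_i\subset\mathbb{H}^3$ the (vertical) geodesic plane whose boundary at infinity contains $v_i$. Suppose that $B_i\cap V_i\neq\emptyset$ for $i=1,2$. Let $P_i$ be the line through $\mathrm{center}(C_i)$ tangent to the disc $\pi(B_i)$ such that $\pi(B_1\cup B_2)$ lies to one side of it, namely the outer one of the two tangent lines: of the two rays that start at $\mathrm{center}(C_i)$ and pass through a point of tangency with $\pi(B_i)$, $P_i$ contains the one making the larger angle with the ray from $\mathrm{center}(C_i)$ towards the center of the other horoball $C_j$, $j\ne i$. Let $\alpha$ (respectively $\beta$) be the acute angle, in $[0,\pi/2)$, between $P_1$ and $v_1$ (respectively between $P_2$ and $v_2$). Then: 1. $\alpha+\beta\le \pi/3$. 2. If $\alpha+\beta=\pi/3$, then (a) $C_1$ is tangent to $C_2$; (b) $B_1$ and $B_2$ are full-sized; (c) for $i=1,2$, $B_i$ is tangent to $C_i$, and the line through $\mathrm{center}(B_1)$ and $\mathrm{center}(B_2)$ is parallel to $L$.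
   Context: Work in the upper half-space model of hyperbolic space $\mathbb{H}^3=\{(x,y,z): z>0\}$, with vertical projection $\pi:\mathbb{H}^3\to\mathbb{R}^2$, $\pi(x,y,z)=(x,y)$. All horoballs considered here are closed and centered at points of $\mathbb{R}^2\subset\partial_\infty\mathbb{H}^3$ (Euclidean balls tangent to the plane $z=0$); $\mathrm{center}(B)\in\mathbb{R}^2$ denotes the point at infinity of the horoball $B$. The Euclidean height of a horoball is its Euclidean diameter, so $\pi(B)$ is a disc of radius half the height centered at $\mathrm{center}(B)$. A horoball is full-sized if $\pi(B)$ has radius $1/2$ (height $1$). Two horoballs are tangent if they intersect and have disjoint interiors. *)

theory Defs
  imports "HOL-Analysis.Analysis"
begin

section \<open>Horoballs in the upper half-space model\<close>

text \<open>
  A point of the closed half-space is a pair of its horizontal part in the plane and its vertical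
  coordinate. The metric of the product type is the Euclidean one. A point \<open>p\<close> of the plane is
  identified with the ideal point \<open>(p, 0)\<close>.
\<close>

type_synonym plane = "real ^ 2"
type_synonym space = "plane \<times> real"

definition H3 :: "space set" where
  "H3 = {x. snd x > 0}"

definition proj :: "space \<Rightarrow> plane" where
  "proj x = fst x"

text \<open>
  The intersection with \<open>H3\<close> removes from the closed ball exactly its point of tangency \<open>(c, 0)\<close>
  with the boundary plane.
\<close>

definition horoball_at :: "plane \<Rightarrow> real \<Rightarrow> space set" where
  "horoball_at c h = cball (c, h / 2) (h / 2) \<inter> H3"

definition horoball :: "space set \<Rightarrow> bool" where
  "horoball B \<longleftrightarrow> (\<exists>c h. h > 0 \<and> B = horoball_at c h)"

definition center :: "space set \<Rightarrow> plane" where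
  "center B = (THE c. \<exists>h>0. B = horoball_at c h)"

definition height :: "space set \<Rightarrow> real" where
  "height B = diameter B"

definition full_sized :: "space set \<Rightarrow> bool" where
  "full_sized B \<longleftrightarrow> (\<exists>c. proj ` B = cball c (1 / 2))"

definition tangent_horoballs :: "space set \<Rightarrow> space set \<Rightarrow> bool" where
  "tangent_horoballs A B \<longleftrightarrow> A \<inter> B \<noteq> {} \<and> interior A \<inter> interior B = {}"

lemma proj_horoball_at:
  assumes "h > 0"
  shows "proj ` horoball_at c h = cball c (h / 2)"
proof
  show "proj ` horoball_at c h \<subseteq> cball c (h / 2)"
  proof
    fix p assume "p \<in> proj ` horoball_at c h"
    then obtain t where "dist (c, h / 2) (p, t) \<le> h / 2"
      by (auto simp: horoball_at_def proj_def)
    then show "p \<in> cball c (h / 2)"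
      using dist_fst_le[of "(c, h / 2)" "(p, t)"] by simp
  qed
  show "cball c (h / 2) \<subseteq> proj ` horoball_at c h"
  proof
    fix p assume "p \<in> cball c (h / 2)"
    then have "(p, h / 2) \<in> horoball_at c h"
      using assms by (simp add: horoball_at_def H3_def dist_Pair_Pair)
    then show "p \<in> proj ` horoball_at c h"
      unfolding proj_def by force
  qed
qed

lemma center_horoball_at:
  assumes "h > 0"
  shows "center (horoball_at c h) = c"
  unfolding center_def
proof (rule the_equality)
  show "\<exists>h'>0. horoball_at c h = horoball_at c h'"
    using assms by blast
next
  fix c' assume "\<exists>h'>0. horoball_at c h = horoball_at c' h'"
  then obtain h' where "h' > 0" "cball c (h / 2) = cball c' (h' / 2)"
    using assms proj_horoball_at by metis
  then show "c' = c"
    using assms by (auto simp: cball_eq_cball_iff)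
qed

lemma height_horoball_at:
  assumes "h > 0"
  shows "height (horoball_at c h) = h"
proof -
  have 1: "ball (c, h / 2) (h / 2) \<subseteq> horoball_at c h"
  proof
    fix x assume x: "x \<in> ball (c, h / 2) (h / 2)"
    have "dist (h / 2) (snd x) < h / 2"
      using x dist_snd_le[of "(c, h / 2)" x] by simp
    then have "snd x > 0"
      by (simp add: dist_real_def abs_if split: if_splits)
    then show "x \<in> horoball_at c h"
      using x by (simp add: horoball_at_def H3_def)
  qed
  have 2: "horoball_at c h \<subseteq> cball (c, h / 2) (h / 2)"
    by (simp add: horoball_at_def)
  have "diameter (ball (c, h / 2) (h / 2)) \<le> diameter (horoball_at c h)"
    by (rule diameter_subset[OF 1 bounded_subset[OF bounded_cball 2]])
  moreover have "diameter (horoball_at c h) \<le> diameter (cball (c, h / 2) (h / 2))"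
    by (rule diameter_subset[OF 2 bounded_cball])
  ultimately show ?thesis
    using assms by (simp add: height_def)
qed

section \<open>Lines and angles in the plane\<close>

definition is_line :: "plane set \<Rightarrow> bool" where
  "is_line l \<longleftrightarrow> affine l \<and> aff_dim l = 1"

definition line_through :: "plane \<Rightarrow> plane \<Rightarrow> plane set" where
  "line_through p q = affine hull {p, q}"

definition perp_line :: "plane set \<Rightarrow> plane \<Rightarrow> plane set" where
  "perp_line l p = {q. \<forall>x\<in>l. \<forall>y\<in>l. orthogonal (q - p) (x - y)}"

definition vertical_plane :: "plane set \<Rightarrow> space set" where
  "vertical_plane l = {x \<in> H3. proj x \<in> l}"

definition vec_angle :: "plane \<Rightarrow> plane \<Rightarrow> real" where
  "vec_angle u w = arccos (u \<bullet> w / (norm u * norm w))"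

text \<open>
  For two lines the set below consists of an angle and its supplement, so that its infimum is the
  angle in \<open>[0, pi/2]\<close>.
\<close>

definition line_angle :: "plane set \<Rightarrow> plane set \<Rightarrow> real" where
  "line_angle l m =
     Inf {vec_angle (q - p) (s - r) | p q r s. p \<in> l \<and> q \<in> l \<and> p \<noteq> q \<and> r \<in> m \<and> s \<in> m \<and> r \<noteq> s}"

definition on_one_side :: "plane set \<Rightarrow> plane set \<Rightarrow> bool" where
  "on_one_side S l \<longleftrightarrow> (\<exists>a b. a \<noteq> 0 \<and> l = {x. a \<bullet> x = b} \<and> S \<subseteq> {x. a \<bullet> x \<le> b})"

text \<open>The line \<open>l\<close> is tangent to the closed disc \<open>D\<close> at \<open>t\<close>.\<close>

definition tangent_at :: "plane set \<Rightarrow> plane set \<Rightarrow> plane \<Rightarrow> bool" where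
  "tangent_at l D t \<longleftrightarrow> is_line l \<and> l \<inter> D = {t}"

text \<open>
  Of the tangent lines to \<open>D\<close> through the point \<open>c\<close> outside \<open>D\<close>, the one whose ray from \<open>c\<close> through
  its point of tangency makes the larger angle with the ray from \<open>c\<close> towards \<open>c'\<close>.
\<close>

definition outer_tangent :: "plane \<Rightarrow> plane \<Rightarrow> plane set \<Rightarrow> plane set \<Rightarrow> bool" where
  "outer_tangent c c' D P \<longleftrightarrow>
     (\<exists>t. c \<in> P \<and> tangent_at P D t \<and>
       (\<forall>l t'. c \<in> l \<and> tangent_at l D t' \<and> t' \<noteq> t \<longrightarrow>
          vec_angle (t' - c) (c' - c) < vec_angle (t - c) (c' - c)))"

end

theory Submission
  imports Defs
begin

text \<open>
  Let \<open>c\<^sub>i\<close>, \<open>b\<^sub>i\<close> be the centres of \<open>C\<^sub>i\<close>, \<open>B\<^sub>i\<close>, let \<open>r\<^sub>i = \<bar>b\<^sub>i - c\<^sub>i\<bar>\<close>, and let \<open>u\<^sub>i\<close> be the signed distance by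
  which \<open>b\<^sub>i\<close> lies beyond \<open>v\<^sub>i\<close>, seen from the other full-sized horoball. The outer tangent makes
  the angle \<open>arcsin (h\<^sub>i / (2 r\<^sub>i)) + arcsin (u\<^sub>i / r\<^sub>i)\<close> with \<open>v\<^sub>i\<close>. Horoballs of heights \<open>h\<close> and \<open>k\<close> have
  disjoint interiors iff the squared distance of their centres is at least \<open>h k\<close>; hence
  \<open>r\<^sub>i\<^sup>2 \<ge> h\<^sub>i\<close>, \<open>\<bar>c\<^sub>1 - c\<^sub>2\<bar> \<ge> 1\<close> and, projecting \<open>b\<^sub>2 - b\<^sub>1\<close> to \<open>L\<close>, \<open>u\<^sub>1 + u\<^sub>2 \<le> sqrt (h\<^sub>1 h\<^sub>2) - 1 \<le> 0\<close>.
  So at most one \<open>u\<^sub>i\<close> is positive, and the sum of the angles is maximised one variable at a time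
  by monotonicity. At the maximum \<open>c\<^sub>1, c\<^sub>2, b\<^sub>2, b\<^sub>1\<close> is a rhombus of side length 1.
\<close>

section \<open>Maximising the sum of the angles\<close>

text \<open>As a function of the reciprocal \<open>t\<close> of the denominator, the difference has
  derivative \<open>a / sqrt (1 - (a t)^2) - b / sqrt (1 - (b t)^2)\<close>, which is nonnegative
  because \<open>b \<le> a\<close>. It is meant for a horoball whose two arcsine terms have opposite
  signs, where bounding each term separately in the distance would lose too much.\<close>

lemma arcsin_diff_antimono:
  fixes a b q r :: real
  assumes "0 \<le> b" "b \<le> a" "a < q" "q \<le> r"
  shows "arcsin (a / r) - arcsin (b / r) \<le> arcsin (a / q) - arcsin (b / q)"
proof -
  have q: "0 < q" "0 < r" using assms by auto
  have "arcsin (a * (1 / r)) - arcsin (b * (1 / r)) \<le> arcsin (a * (1 / q)) - arcsin (b * (1 / q))"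
  proof (rule DERIV_nonneg_imp_nondecreasing[where f = "\<lambda>s. arcsin (a * s) - arcsin (b * s)"])
    show "1 / r \<le> 1 / q" using assms q by (simp add: frac_le)
    fix s assume s: "1 / r \<le> s" "s \<le> 1 / q"
    have "0 < 1 / r" using q by simp
    then have s0: "0 \<le> s" using s by linarith
    have "a * s \<le> a * (1 / q)" using s assms by (intro mult_left_mono) auto
    also have "\<dots> < 1" using assms q by simp
    finally have as: "a * s < 1" .
    have bs: "b * s \<le> a * s" "0 \<le> b * s" using assms s0 by (auto intro: mult_right_mono)
    have sq: "(b * s)\<^sup>2 \<le> (a * s)\<^sup>2" using bs by (intro power_mono)
    have pos: "0 < 1 - (a * s)\<^sup>2" using as bs by (simp add: abs_square_less_1)
    let ?f' = "a * inverse (sqrt (1 - (a * s)\<^sup>2)) - b * inverse (sqrt (1 - (b * s)\<^sup>2))"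
    have "((\<lambda>s. arcsin (a * s) - arcsin (b * s)) has_real_derivative ?f') (at s)"
      using as bs by (auto intro!: derivative_eq_intros)
    moreover have "0 \<le> ?f'"
      using assms sq pos by (simp, intro mult_mono) (auto intro!: le_imp_inverse_le)
    ultimately show "\<exists>y. ((\<lambda>s. arcsin (a * s) - arcsin (b * s)) has_real_derivative y) (at s) \<and> 0 \<le> y"
      by blast
  qed
  then show ?thesis by simp
qed

text \<open>The left side increases in \<open>u\<close>, so the value at the right end
  \<open>u = p - 1 / 2\<close> bounds it. There the second arcsine becomes
  \<open>arcsin (1 / 2) = pi / 6\<close>.\<close>

lemma arcsin_diff_bound:
  fixes p u :: real
  assumes "0 < p" "p \<le> 1" "0 \<le> u" "u \<le> p - 1 / 2"
  shows "arcsin (u / p) - arcsin (u + 1 - p) \<le> arcsin (1 - 1 / (2 * p)) - pi / 6"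
proof -
  have "arcsin (u / p) - arcsin (u + 1 - p)
      \<le> arcsin ((p - 1 / 2) / p) - arcsin ((p - 1 / 2) + 1 - p)"
  proof (rule DERIV_nonneg_imp_nondecreasing[OF assms(4),
        where f = "\<lambda>u. arcsin (u / p) - arcsin (u + 1 - p)"])
    fix x assume x: "u \<le> x" "x \<le> p - 1 / 2"
    have x0: "0 \<le> x" "x < p" using x assms by auto
    have "x\<^sup>2 < p\<^sup>2" using x0 by (intro power_strict_mono) auto
    then have pos: "0 < p\<^sup>2 - x\<^sup>2" by simp
    \<comment> \<open>The two derivatives are the reciprocal square roots of
      \<open>p\<^sup>2 - x\<^sup>2\<close> and \<open>1 - (x + 1 - p)\<^sup>2\<close>; the
      factorisation compares them.\<close>
    have "1 - (x + 1 - p)\<^sup>2 - (p\<^sup>2 - x\<^sup>2) = 2 * ((1 - p) * (p - x))"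
      by (simp add: power2_eq_square algebra_simps)
    also have "\<dots> \<ge> 0" using x0 assms by simp
    finally have le: "p\<^sup>2 - x\<^sup>2 \<le> 1 - (x + 1 - p)\<^sup>2" by simp
    have "p * sqrt (1 - (x / p)\<^sup>2) = sqrt (p\<^sup>2 * (1 - (x / p)\<^sup>2))"
      using assms by (simp add: real_sqrt_mult)
    also have "p\<^sup>2 * (1 - (x / p)\<^sup>2) = p\<^sup>2 - x\<^sup>2"
      using assms by (simp add: field_simps)
    finally have eq: "p * sqrt (1 - (x / p)\<^sup>2) = sqrt (p\<^sup>2 - x\<^sup>2)" .
    let ?f' = "inverse (sqrt (1 - (x / p)\<^sup>2)) * (1 / p) - inverse (sqrt (1 - (x + 1 - p)\<^sup>2)) * 1"
    have "((\<lambda>u. arcsin (u / p) - arcsin (u + 1 - p)) has_real_derivative ?f') (at x)"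
    proof (intro DERIV_diff DERIV_chain2[OF DERIV_arcsin])
      have "0 \<le> x / p" using x0 by simp
      then show "- 1 < x / p" by linarith
      show "x / p < 1" using x0 by simp
    qed (use x0 x assms in \<open>auto intro!: derivative_eq_intros\<close>)
    moreover have "?f' = 1 / sqrt (p\<^sup>2 - x\<^sup>2) - 1 / sqrt (1 - (x + 1 - p)\<^sup>2)"
      unfolding eq[symmetric] by (simp add: divide_inverse)
    then have "0 \<le> ?f'" using pos le by (simp add: frac_le)
    ultimately show "\<exists>y. ((\<lambda>u. arcsin (u / p) - arcsin (u + 1 - p)) has_real_derivative y) (at x) \<and> 0 \<le> y"
      by blast
  qed
  also have "(p - 1 / 2) / p = 1 - 1 / (2 * p)" using assms by (simp add: field_simps)
  finally show ?thesis by simp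
qed

lemma arcsin_half_le:
  fixes x :: real
  assumes "0 \<le> x" "x \<le> 1"
  shows "arcsin (x / 2) \<le> pi / 6" and "arcsin (x / 2) = pi / 6 \<Longrightarrow> x = 1"
proof -
  have "arcsin (x / 2) \<le> arcsin (1 / 2)" using assms by (intro arcsin_le_arcsin) auto
  then show "arcsin (x / 2) \<le> pi / 6" by simp
  show "x = 1" if "arcsin (x / 2) = pi / 6"
  proof -
    have "sin (arcsin (x / 2)) = sin (pi / 6)" by (simp only: that)
    moreover have "sin (arcsin (x / 2)) = x / 2" using assms by (intro sin_arcsin) auto
    ultimately show ?thesis by (simp add: sin_30)
  qed
qed

text \<open>With \<open>p\<^sup>2\<close> the height of a horoball, the left side is half the angle
  under which its projected disc is seen from distance \<open>r\<close>. It is largest at the least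
  possible distance \<open>r = p\<close>, where the horoball touches the full-sized one.\<close>

lemma arcsin_tangent_le:
  fixes p r :: real
  assumes "0 < p" "p \<le> 1" "p \<le> r"
  shows "arcsin (p\<^sup>2 / (2 * r)) \<le> arcsin (p / 2)"
    and "arcsin (p\<^sup>2 / (2 * r)) = arcsin (p / 2) \<Longrightarrow> r = p"
proof -
  have "p * p \<le> p * r" using assms by (intro mult_left_mono) auto
  then have le: "p\<^sup>2 / (2 * r) \<le> p / 2" using assms by (simp add: field_simps power2_eq_square)
  have lo: "0 \<le> p\<^sup>2 / (2 * r)" using assms by simp
  show "arcsin (p\<^sup>2 / (2 * r)) \<le> arcsin (p / 2)"
    using le lo assms by (intro arcsin_le_arcsin) linarith+
  show "r = p" if "arcsin (p\<^sup>2 / (2 * r)) = arcsin (p / 2)"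
  proof -
    have "\<bar>p\<^sup>2 / (2 * r)\<bar> \<le> 1" "\<bar>p / 2\<bar> \<le> 1" using le lo assms by linarith+
    then have "p\<^sup>2 / (2 * r) = p / 2" using that arcsin_eq_iff by blast
    then show ?thesis using assms by (simp add: field_simps power2_eq_square)
  qed
qed

text \<open>
  After estimating away \<open>r\<close>, \<open>s\<close> and then \<open>q\<close>, the bound increases in \<open>u\<close> up to its largest
  admissible value \<open>p - 1 / 2\<close>, and there it increases in \<open>p\<close>.
\<close>

lemma angle_sum_opposite:
  fixes p q r s u w :: real
  assumes p: "0 < p" "p \<le> 1" and q: "0 < q" "q \<le> 1" and rs: "p \<le> r" "q \<le> s"
    and u: "0 \<le> u" and w: "w \<le> q\<^sup>2 / 2" "u + 1 - p * q \<le> w"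
  defines "S \<equiv> arcsin (p\<^sup>2 / (2 * r)) + arcsin (u / r) + arcsin (q\<^sup>2 / (2 * s)) - arcsin (w / s)"
  shows "S \<le> pi / 3" and "S = pi / 3 \<Longrightarrow> p = 1 \<and> q = 1 \<and> r = 1 \<and> w = u"
proof -
  have pq: "p * q \<le> 1" using p q by (simp add: mult_le_one)
  have w0: "0 \<le> w" using w u pq by linarith
  have q2: "q\<^sup>2 \<le> q" using q by (simp add: power2_eq_square mult_left_le)
  \<comment> \<open>This removes \<open>q\<close> from the lower bound for \<open>w / q\<close>.
    Together with \<open>w / q \<le> q / 2 \<le> 1 / 2\<close> it yields the range
    \<open>u \<le> p - 1 / 2\<close>.\<close>
  have "u + 1 - p \<le> (u + 1 - p * q) / q"
  proof -
    have "(u + 1) * q \<le> u + 1" using u q by (intro mult_left_le) auto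
    then show ?thesis using q by (simp add: field_simps)
  qed
  also have wq1: "\<dots> \<le> w / q" using w q by (simp add: divide_right_mono)
  finally have wq: "u + 1 - p \<le> w / q" .
  have wq2: "w / q \<le> q / 2" using w q by (simp add: field_simps power2_eq_square)
  have up: "u \<le> p - 1 / 2" using wq wq2 q by linarith
  have p2: "1 / 2 \<le> p" using up u by linarith
  have t1: "arcsin (p\<^sup>2 / (2 * r)) \<le> arcsin (p / 2)"
    by (rule arcsin_tangent_le(1)) (use p rs in auto)
  have "u / r \<le> u / p" using u p rs by (simp add: frac_le)
  then have t2: "arcsin (u / r) \<le> arcsin (u / p)"
    using u up p rs by (intro arcsin_le_arcsin) (auto simp: field_simps)
  have "arcsin (q\<^sup>2 / 2 / s) - arcsin (w / s) \<le> arcsin (q\<^sup>2 / 2 / q) - arcsin (w / q)"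
    using w w0 q q2 rs by (intro arcsin_diff_antimono) auto
  then have t3: "arcsin (q\<^sup>2 / (2 * s)) - arcsin (w / s) \<le> arcsin (q / 2) - arcsin (w / q)"
    using q by (simp add: power2_eq_square)
  have t4: "arcsin (q / 2) \<le> pi / 6" using q by (intro arcsin_half_le) auto
  have t5: "arcsin (u + 1 - p) \<le> arcsin (w / q)"
    using wq wq2 u p q by (intro arcsin_le_arcsin) linarith+
  have t6: "arcsin (u / p) - arcsin (u + 1 - p) \<le> arcsin (1 - 1 / (2 * p)) - pi / 6"
    using p u up by (intro arcsin_diff_bound)
  have t7: "arcsin (p / 2) \<le> pi / 6" using p by (intro arcsin_half_le) auto
  have "1 - 1 / (2 * p) \<le> 1 / 2" "0 \<le> 1 - 1 / (2 * p)" using p p2 by (auto simp: field_simps)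
  then have "arcsin (1 - 1 / (2 * p)) \<le> arcsin (1 / 2)" by (intro arcsin_le_arcsin) auto
  then have t8: "arcsin (1 - 1 / (2 * p)) \<le> pi / 6" by simp
  note ts = t1 t2 t3 t4 t5 t6 t7 t8
  show "S \<le> pi / 3" unfolding S_def using ts by linarith
  assume eq: "S = pi / 3"
  \<comment> \<open>The estimates \<open>t1\<close> to \<open>t8\<close> add up to exactly
    \<open>pi / 3\<close>, so equality in the sum makes each of them an equality.\<close>
  have p1: "p = 1" using p eq ts unfolding S_def by (intro arcsin_half_le(2)) linarith+
  have q1: "q = 1" using q eq ts unfolding S_def by (intro arcsin_half_le(2)) linarith+
  have r1: "r = p" by (rule arcsin_tangent_le(2)) (use p rs eq ts in \<open>unfold S_def, linarith+\<close>)
  have "arcsin u = arcsin w" using eq ts p1 q1 unfolding S_def by simp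
  then have "w = u" using wq wq2 w0 u up p1 q1 by (subst (asm) arcsin_eq_iff) auto
  then show "p = 1 \<and> q = 1 \<and> r = 1 \<and> w = u" using p1 q1 r1 by simp
qed

text \<open>Since \<open>p * q \<le> 1 \<le> d\<close>, the offsets satisfy
  \<open>u + w \<le> 0\<close>. If one is positive, \<open>angle_sum_opposite\<close> applies with
  the other one negated; if neither is, the offset terms only lower the sum and each tangent term is
  at most \<open>pi / 6\<close>. Equality fixes just one of the distances: for
  \<open>p = q = r = d = 1\<close>, \<open>u = 1 / 2\<close>, \<open>w = - 1 / 2\<close> the sum is
  \<open>pi / 3\<close> for every \<open>s \<ge> 1\<close>.\<close>

lemma angle_sum:
  fixes p q r s u w d :: real
  assumes p: "0 < p" "p \<le> 1" and q: "0 < q" "q \<le> 1" and rs: "p \<le> r" "q \<le> s"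
    and u: "\<bar>u\<bar> \<le> p\<^sup>2 / 2" and w: "\<bar>w\<bar> \<le> q\<^sup>2 / 2"
    and d: "1 \<le> d" and uw: "d + u + w \<le> p * q"
  defines "S \<equiv> arcsin (p\<^sup>2 / (2 * r)) + arcsin (u / r) + (arcsin (q\<^sup>2 / (2 * s)) + arcsin (w / s))"
  shows "S \<le> pi / 3 \<and>
    (S = pi / 3 \<longrightarrow> p = 1 \<and> q = 1 \<and> d = 1 \<and> u + w = 0 \<and> (r = 1 \<or> s = 1))"
proof -
  have pq: "p * q \<le> 1" using p q by (simp add: mult_le_one)
  have rs0: "0 < r" "0 < s" using p q rs by linarith+
  have "q\<^sup>2 \<le> q" "p\<^sup>2 \<le> p" using p q by (auto simp: power2_eq_square mult_left_le)
  then have "\<bar>w\<bar> \<le> s" "\<bar>u\<bar> \<le> r" using u w p q rs by linarith+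
  then have "\<bar>w / s\<bar> \<le> 1" "\<bar>u / r\<bar> \<le> 1" using rs0 by (simp_all add: abs_divide)
  then have le1: "- 1 \<le> w / s" "w / s \<le> 1" "- 1 \<le> u / r" "u / r \<le> 1" by linarith+
  have neg: "arcsin (- w / s) = - arcsin (w / s)" "arcsin (- u / r) = - arcsin (u / r)"
    using arcsin_minus[of "w / s"] arcsin_minus[of "u / r"] le1 by simp_all
  consider "0 < u" | "0 < w" | "u \<le> 0" "w \<le> 0" by linarith
  then show ?thesis
  proof cases
    case 1
    have *: "0 \<le> u" "- w \<le> q\<^sup>2 / 2" "u + 1 - p * q \<le> - w" using 1 w uw d by auto
    from angle_sum_opposite[OF p q rs *] show ?thesis
      unfolding neg S_def using uw d by auto
  next
    case 2
    have *: "0 \<le> w" "- u \<le> p\<^sup>2 / 2" "w + 1 - q * p \<le> - u" using 2 u uw d by (auto simp: mult.commute)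
    from angle_sum_opposite[OF q p rs(2,1) *] show ?thesis
      unfolding neg S_def using uw d by (auto simp: algebra_simps)
  next
    case 3
    have "arcsin (p\<^sup>2 / (2 * r)) \<le> arcsin (p / 2)" "arcsin (q\<^sup>2 / (2 * s)) \<le> arcsin (q / 2)"
      using p q rs by (auto intro: arcsin_tangent_le(1))
    moreover have "arcsin (p / 2) \<le> pi / 6" "arcsin (q / 2) \<le> pi / 6"
      using arcsin_half_le(1)[of p] arcsin_half_le(1)[of q] p q by auto
    moreover have "arcsin (u / r) \<le> 0" "arcsin (w / s) \<le> 0"
    proof -
      have "w / s \<le> 0" "u / r \<le> 0" using rs0 3 by (auto intro: divide_nonpos_pos)
      then show "arcsin (u / r) \<le> 0" "arcsin (w / s) \<le> 0"
        using le1 arcsin_le_arcsin[of "u / r" 0] arcsin_le_arcsin[of "w / s" 0]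
        by simp_all
    qed
    ultimately have ts: "arcsin (p\<^sup>2 / (2 * r)) \<le> arcsin (p / 2)" "arcsin (q\<^sup>2 / (2 * s)) \<le> arcsin (q / 2)"
      "arcsin (p / 2) \<le> pi / 6" "arcsin (q / 2) \<le> pi / 6" "arcsin (u / r) \<le> 0" "arcsin (w / s) \<le> 0"
      by auto
    have bnd: "S \<le> pi / 3" unfolding S_def using ts by linarith
    have "p = 1 \<and> q = 1 \<and> d = 1 \<and> u + w = 0 \<and> (r = 1 \<or> s = 1)" if eq: "S = pi / 3"
    proof -
      have p1: "p = 1" using p eq ts unfolding S_def by (intro arcsin_half_le(2)) linarith+
      have q1: "q = 1" using q eq ts unfolding S_def by (intro arcsin_half_le(2)) linarith+
      have r1: "r = p" by (rule arcsin_tangent_le(2)) (use p rs eq ts in \<open>unfold S_def, linarith+\<close>)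
      have s1: "s = q" by (rule arcsin_tangent_le(2)) (use q rs eq ts in \<open>unfold S_def, linarith+\<close>)
      have "arcsin u = 0" "arcsin w = 0" using eq ts p1 q1 r1 s1 unfolding S_def by auto
      then have "u = 0" "w = 0" using u w p1 q1 arcsin_eq_iff[of u 0] arcsin_eq_iff[of w 0] by auto
      then show ?thesis using p1 q1 r1 d uw by simp
    qed
    then show ?thesis using bnd by blast
  qed
qed

section \<open>The angle of the outer tangent\<close>

text \<open>Pythagoras for the expansion of \<open>e\<close> in the orthogonal pair
  \<open>a\<close>, \<open>s\<close>, with denominators cleared; it relies on the space being
  two-dimensional.\<close>

lemma gram_orthogonal_plane:
  fixes a s e :: plane
  assumes "a \<bullet> s = 0"
  shows "(s \<bullet> e)\<^sup>2 * (a \<bullet> a) + (a \<bullet> e)\<^sup>2 * (s \<bullet> s) = (a \<bullet> a) * (s \<bullet> s) * (e \<bullet> e)"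
  using assms unfolding inner_vec_def sum_2 inner_real_def by algebra

text \<open>The counterclockwise quarter turn; it supplies a direction vector for the perpendicular
  \<open>v\<^sub>i\<close>.\<close>

definition rot :: "plane \<Rightarrow> plane" where
  "rot v = (\<chi> i. if i = 1 then - (v $ 2) else v $ 1)"

lemma inner_rot [simp]: "rot v \<bullet> v = 0" "v \<bullet> rot v = 0" "rot v \<bullet> rot v = v \<bullet> v"
  by (auto simp: rot_def inner_vec_def sum_2)

lemma vec_angle_arg_bounds: "\<bar>u \<bullet> w / (norm u * norm w)\<bar> \<le> 1"
  using Cauchy_Schwarz_ineq2[of u w]
  by (cases "norm u * norm w = 0") (auto simp: field_simps)

lemma vec_angle_nonneg: "0 \<le> vec_angle u w"
  using vec_angle_arg_bounds[of u w] unfolding vec_angle_def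
  by (intro arccos_lbound) linarith+

text \<open>An infimum is bounded by any one choice of direction vectors. Upper bounds suffice for
  the equality case too, since they sum to at most \<open>pi / 3\<close>.\<close>

lemma line_angle_le:
  assumes "p \<in> l" "q \<in> l" "p \<noteq> q" "r \<in> m" "s \<in> m" "r \<noteq> s"
  shows "line_angle l m \<le> vec_angle (q - p) (s - r)"
  unfolding line_angle_def
proof (rule cInf_lower)
  show "bdd_below {vec_angle (q - p) (s - r) | p q r s. p \<in> l \<and> q \<in> l \<and> p \<noteq> q \<and> r \<in> m \<and> s \<in> m \<and> r \<noteq> s}"
    by (intro bdd_belowI[of _ 0]) (auto simp: vec_angle_nonneg)
qed (use assms in blast)

lemma mem_perp_line:
  assumes "x \<bullet> (b - a) = 0"
  shows "p + x \<in> perp_line (line_through a b) p"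
proof -
  have "orthogonal x (y - z)" if y: "y \<in> line_through a b" and z: "z \<in> line_through a b" for y z
  proof -
    obtain k l where "y = a + k *\<^sub>R (b - a)" "z = a + l *\<^sub>R (b - a)"
      using y z unfolding line_through_def affine_hull_2_alt by auto
    then have "y - z = (k - l) *\<^sub>R (b - a)" by (simp add: scaleR_diff_left)
    then show ?thesis using assms by (simp add: orthogonal_def)
  qed
  then show ?thesis by (simp add: perp_line_def)
qed

text \<open>The hypothesis \<open>x \<bullet> a = x \<bullet> x\<close> says that
  \<open>c + x\<close> is the foot of the perpendicular from the disc's centre \<open>c + a\<close>
  to the line, so Pythagoras splits the squared distance.\<close>

lemma dist_line_cball_iff:
  fixes x a b :: "'a::real_inner"
  assumes "x \<bullet> a = x \<bullet> x" "0 \<le> r"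
  shows "c + k *\<^sub>R x \<in> cball (c + a) r \<longleftrightarrow> (x \<bullet> x) * (k - 1)\<^sup>2 + (a \<bullet> a - x \<bullet> x) \<le> r\<^sup>2"
proof -
  have "c + k *\<^sub>R x \<in> cball (c + a) r \<longleftrightarrow> norm (a - k *\<^sub>R x) \<le> r"
    by (simp add: dist_norm)
  also have "\<dots> \<longleftrightarrow> (norm (a - k *\<^sub>R x))\<^sup>2 \<le> r\<^sup>2"
    using assms(2) by (simp add: abs_le_square_iff[symmetric])
  also have "(norm (a - k *\<^sub>R x))\<^sup>2 = (x \<bullet> x) * (k - 1)\<^sup>2 + (a \<bullet> a - x \<bullet> x)"
    using assms(1) unfolding power2_norm_eq_inner
    by (simp add: algebra_simps inner_diff inner_commute power2_eq_square)
  finally show ?thesis .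
qed

lemma tangent_atD:
  assumes c: "c \<in> P" and t: "tangent_at P (cball (c + a) r) (c + x)" and r: "0 < r" "r < norm a"
  shows "x \<bullet> a = x \<bullet> x" "x \<bullet> x = a \<bullet> a - r\<^sup>2"
proof -
  let ?D = "cball (c + a) r"
  have P: "affine P" "P \<inter> ?D = {c + x}" using t by (auto simp: tangent_at_def is_line_def)
  have xP: "c + x \<in> P" "c + x \<in> ?D" using P(2) by blast+
  have x0: "x \<noteq> 0" using xP(2) r by (auto simp: dist_norm)
  then have xx: "0 < x \<bullet> x" by simp
  have line: "c + k *\<^sub>R x \<in> P" for k
  proof -
    have "(1 - k) *\<^sub>R c + k *\<^sub>R (c + x) \<in> P"
      using P(1) c xP(1) unfolding affine_def by (metis diff_add_cancel)
    then show ?thesis by (simp add: algebra_simps)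
  qed
  have uniq: "k = 1" if "c + k *\<^sub>R x \<in> ?D" for k
  proof -
    have "c + k *\<^sub>R x = c + x" using that line[of k] P(2) by blast
    then have "(k - 1) *\<^sub>R x = 0" by (simp add: algebra_simps)
    then show ?thesis using x0 by simp
  qed
  have nle: "norm (a - x) \<le> r" using xP(2) by (simp add: dist_norm)
  \<comment> \<open>The parameter of the foot of the perpendicular from the centre. The foot is no
    farther from the centre than \<open>c + x\<close>, so it lies in the disc and must be
    \<open>c + x\<close> itself.\<close>
  define k where "k = x \<bullet> a / (x \<bullet> x)"
  have "(norm (a - k *\<^sub>R x))\<^sup>2 = (norm (a - x))\<^sup>2 - (x \<bullet> x) * (k - 1)\<^sup>2"
  proof -
    have "x \<bullet> a = k * (x \<bullet> x)" using xx by (simp add: k_def)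
    then show ?thesis unfolding power2_norm_eq_inner
      by (simp add: algebra_simps inner_diff inner_commute power2_eq_square)
  qed
  also have "\<dots> \<le> (norm (a - x))\<^sup>2" using xx by simp
  finally have "norm (a - k *\<^sub>R x) \<le> norm (a - x)" by (simp add: abs_le_square_iff[symmetric])
  then have "c + k *\<^sub>R x \<in> ?D" using nle by (simp add: dist_norm)
  then have "k = 1" by (rule uniq)
  then show xa: "x \<bullet> a = x \<bullet> x" using xx by (simp add: k_def)
  note iff = dist_line_cball_iff[OF xa, of r c]
  have le: "a \<bullet> a - x \<bullet> x \<le> r\<^sup>2" using iff[of 1] xP(2) r by simp
  \<comment> \<open>Half the length of the chord in units of \<open>norm x\<close>. Its endpoint at
    parameter \<open>1 + m\<close> lies in the disc, so the chord degenerates and the foot is on the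
    circle.\<close>
  define m where "m = sqrt ((r\<^sup>2 - (a \<bullet> a - x \<bullet> x)) / (x \<bullet> x))"
  have m2: "m\<^sup>2 = (r\<^sup>2 - (a \<bullet> a - x \<bullet> x)) / (x \<bullet> x)" using le xx by (simp add: m_def)
  have "c + (1 + m) *\<^sub>R x \<in> ?D" using iff[of "1 + m"] r xx m2 by simp
  then have "m = 0" using uniq by fastforce
  then show "x \<bullet> x = a \<bullet> a - r\<^sup>2" using m2 xx by simp
qed

text \<open>Converse of \<open>tangent_atD\<close>; it produces the mirror tangent with which the
  outer one is compared.\<close>

lemma tangent_atI:
  assumes "x \<bullet> a = x \<bullet> x" "x \<bullet> x = a \<bullet> a - r\<^sup>2" "0 < r" "r < norm a"
  shows "tangent_at (affine hull {c, c + x}) (cball (c + a) r) (c + x)"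
proof -
  have "r\<^sup>2 < (norm a)\<^sup>2" using assms by (intro power_strict_mono) auto
  then have xx: "0 < x \<bullet> x" using assms by (simp add: power2_norm_eq_inner)
  then have x0: "x \<noteq> 0" by auto
  have mem: "c + k *\<^sub>R x \<in> cball (c + a) r \<longleftrightarrow> k = 1" for k
    using dist_line_cball_iff[OF assms(1), of r c k] assms(2,3) xx
    by (auto simp: mult_le_0_iff)
  have "affine hull {c, c + x} = range (\<lambda>k. c + k *\<^sub>R x)"
    unfolding affine_hull_2_alt by simp
  moreover have "c + x \<in> range (\<lambda>k. c + k *\<^sub>R x)" by (rule range_eqI[of _ _ 1]) simp
  ultimately have "affine hull {c, c + x} \<inter> cball (c + a) r = {c + x}"
    using mem mem[of 1] by auto
  then show ?thesis
    using x0 by (simp add: tangent_at_def is_line_def aff_dim_2)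
qed

text \<open>
  The two points of tangency are exchanged by the reflection in the line through \<open>c\<close> and the
  centre \<open>c + a\<close> of the disc; this determines the sign of the component of \<open>x\<close> orthogonal to \<open>a\<close>.
\<close>

lemma outer_tangent_inner:
  assumes P: "outer_tangent c c' (cball (c + a) r) P"
    and r: "0 < r" "r < norm a" and cc: "c \<noteq> c'"
    and u: "(c' - c) \<bullet> a = - u * norm (c' - c)" "\<bar>u\<bar> \<le> norm a"
  obtains x where "x \<noteq> 0" "c \<in> P" "c + x \<in> P"
    "x \<bullet> (c' - c) = - (norm x * norm (c' - c) * sin (arcsin (r / norm a) + arcsin (u / norm a)))"
proof -
  define R where "R = norm a"
  define e where "e = c' - c"
  have R: "0 < R" "r < R" using r unfolding R_def by auto
  have aa: "a \<bullet> a = R\<^sup>2" by (simp add: R_def power2_norm_eq_inner)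
  have e0: "0 < norm e" using cc by (simp add: e_def)
  obtain t where cP: "c \<in> P" and tan: "tangent_at P (cball (c + a) r) t"
    and outer: "\<And>l t'. c \<in> l \<Longrightarrow> tangent_at l (cball (c + a) r) t' \<Longrightarrow> t' \<noteq> t \<Longrightarrow>
          vec_angle (t' - c) (c' - c) < vec_angle (t - c) (c' - c)"
    using P unfolding outer_tangent_def by auto
  define x where "x = t - c"
  have t: "t = c + x" by (simp add: x_def)
  define m where "m = sqrt (R\<^sup>2 - r\<^sup>2)"
  have "r\<^sup>2 < R\<^sup>2" using R r by (intro power_strict_mono) auto
  then have m: "0 < m" "m\<^sup>2 = R\<^sup>2 - r\<^sup>2" by (auto simp: m_def)
  have xa: "x \<bullet> a = m\<^sup>2" and xx: "x \<bullet> x = m\<^sup>2"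
    using tangent_atD[OF cP tan[unfolded t] r] aa m by auto
  have nx: "norm x = m" using xx m(1) by (simp add: norm_eq_sqrt_inner)
  \<comment> \<open>Chosen so that \<open>k *\<^sub>R a\<close> is the orthogonal projection of
    \<open>x\<close> to the direction of \<open>a\<close>; \<open>s\<close> is the rest.\<close>
  define k where "k = m\<^sup>2 / R\<^sup>2"
  have k: "k * R\<^sup>2 = m\<^sup>2" using R by (simp add: k_def)
  define s where "s = x - k *\<^sub>R a"
  have as: "a \<bullet> s = 0" using xa aa k by (simp add: s_def inner_diff inner_commute)
  have kk: "k * (R\<^sup>2 - m\<^sup>2) = (m * r / R)\<^sup>2"
    using m R by (simp add: k_def power_divide power_mult_distrib)
  have "s \<bullet> s = m\<^sup>2 - 2 * (k * m\<^sup>2) + k * (k * R\<^sup>2)"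
    using xa xx aa by (simp add: s_def inner_diff inner_commute algebra_simps)
  also have "\<dots> = k * (R\<^sup>2 - m\<^sup>2)" unfolding k using k by (simp add: algebra_simps)
  finally have ss: "s \<bullet> s = (m * r / R)\<^sup>2" using kk by simp
  have "0 < (m * r / R)\<^sup>2" using m r R by simp
  then have s0: "s \<noteq> 0" using ss by auto
  define x' where "x' = k *\<^sub>R a - s"
  have xs: "x = k *\<^sub>R a + s" by (simp add: s_def)
  have x'a: "x' \<bullet> a = m\<^sup>2" using as aa k by (simp add: x'_def inner_diff inner_commute)
  have "x' \<bullet> x' = x \<bullet> x" using as unfolding x'_def xs
    by (simp add: inner_diff inner_add inner_commute)
  then have x'x': "x' \<bullet> x' = m\<^sup>2" using xx by simp
  have nx': "norm x' = m" using x'x' m(1) by (simp add: norm_eq_sqrt_inner)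
  have "tangent_at (affine hull {c, c + x'}) (cball (c + a) r) (c + x')"
    using x'a x'x' m aa r by (intro tangent_atI) auto
  moreover have "c + x' \<noteq> t"
  proof
    assume "c + x' = t"
    then have "2 *\<^sub>R s = 0" unfolding t x'_def xs by (simp add: scaleR_2 algebra_simps)
    then show False using s0 by simp
  qed
  ultimately have "vec_angle x' e < vec_angle x e"
    using outer[of "affine hull {c, c + x'}" "c + x'"] hull_inc[of c "{c, c + x'}"]
    by (simp add: t e_def)
  \<comment> \<open>\<open>arccos\<close> is decreasing, and \<open>x\<close>, \<open>x'\<close>
    have equal norm and differ only in the sign of \<open>s\<close>; so the larger angle at
    \<open>x\<close> means \<open>s \<bullet> e < 0\<close>. The Gram identity below supplies the
    absolute value.\<close>
  then have "x \<bullet> e / (norm x * norm e) < x' \<bullet> e / (norm x' * norm e)"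
    unfolding vec_angle_def using vec_angle_arg_bounds[of x e] vec_angle_arg_bounds[of x' e]
    by (subst (asm) arccos_less_mono) auto
  then have "x \<bullet> e < x' \<bullet> e" using m e0 by (simp add: nx nx' divide_less_cancel)
  then have se: "s \<bullet> e < 0" by (simp add: x'_def xs inner_diff inner_add)
  have ae: "a \<bullet> e = - u * norm e" using u by (simp add: e_def inner_commute)
  have uR: "u\<^sup>2 \<le> R\<^sup>2" using u(2) R by (simp add: R_def abs_le_square_iff[symmetric])
  have "(s \<bullet> e)\<^sup>2 * R\<^sup>2 = (m * r / R)\<^sup>2 * (norm e)\<^sup>2 * (R\<^sup>2 - u\<^sup>2)"
    using gram_orthogonal_plane[OF as, of e]
    by (simp add: aa ss ae power2_norm_eq_inner[of e, symmetric] power_mult_distrib[of u]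
        algebra_simps)
  also have "\<dots> = (m * r / R * norm e * sqrt (R\<^sup>2 - u\<^sup>2))\<^sup>2"
    using uR by (simp only: power_mult_distrib real_sqrt_pow2 diff_ge_0_iff_ge)
  finally have "(- (s \<bullet> e) * R)\<^sup>2 = (m * r / R * norm e * sqrt (R\<^sup>2 - u\<^sup>2))\<^sup>2"
    by (simp add: power_mult_distrib)
  then have "- (s \<bullet> e) * R = m * r / R * norm e * sqrt (R\<^sup>2 - u\<^sup>2)"
    using se R m r uR
    by (subst (asm) power2_eq_iff_nonneg) (auto simp: mult_nonneg_nonpos2 mult_nonpos_nonneg)
  then have seq: "s \<bullet> e = - (m * r * norm e * sqrt (R\<^sup>2 - u\<^sup>2) / R\<^sup>2)"
    using R by (simp add: field_simps power2_eq_square)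
  have bnd: "\<bar>u / R\<bar> \<le> 1" "\<bar>r / R\<bar> \<le> 1" using u(2) R r by (auto simp: R_def)
  have cs: "cos (arcsin (v / R)) = sqrt (R\<^sup>2 - v\<^sup>2) / R" if "\<bar>v / R\<bar> \<le> 1" for v
  proof -
    have "cos (arcsin (v / R)) = sqrt (1 - (v / R)\<^sup>2)"
      using that by (intro cos_arcsin) linarith+
    also have "1 - (v / R)\<^sup>2 = (R\<^sup>2 - v\<^sup>2) / R\<^sup>2" using R by (simp add: field_simps)
    finally show ?thesis using R by (simp add: real_sqrt_divide)
  qed
  have "sin (arcsin (r / R) + arcsin (u / R))
      = r / R * (sqrt (R\<^sup>2 - u\<^sup>2) / R) + m / R * (u / R)"
    unfolding sin_add cs[OF bnd(1)] cs[OF bnd(2)] m_def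
    using bnd by (simp only: sin_arcsin abs_le_iff minus_le_iff)
  then have sn: "sin (arcsin (r / R) + arcsin (u / R)) = (r * sqrt (R\<^sup>2 - u\<^sup>2) + m * u) / R\<^sup>2"
    by (simp add: add_divide_distrib power2_eq_square)
  have "x \<bullet> e = - (m * norm e * ((r * sqrt (R\<^sup>2 - u\<^sup>2) + m * u) / R\<^sup>2))"
    unfolding xs inner_add_left inner_scaleR_left seq ae k_def
    using R by (simp add: field_simps power2_eq_square)
  then have "x \<bullet> e = - (norm x * norm e * sin (arcsin (r / R) + arcsin (u / R)))"
    by (simp add: sn nx)
  moreover have "x \<noteq> 0" using nx m by auto
  moreover have "c + x \<in> P" using tan by (auto simp: t tangent_at_def)
  ultimately show ?thesis using cP that unfolding R_def e_def by blast
qed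

text \<open>The previous lemma gives the sine of the angle through the component of \<open>x\<close>
  along the line of centres. The angle lies in \<open>[0, pi/2]\<close>:
  \<open>\<bar>u\<bar> \<le> r\<close> makes it nonnegative, and \<open>2 * r \<le> norm a\<close>
  bounds each arcsine by \<open>pi / 6\<close>. Hence its cosine is the nonnegative root.\<close>

lemma outer_tangent_angle:
  assumes P: "outer_tangent c c' (cball (c + a) r) P"
    and r: "0 < r" "2 * r \<le> norm a" and cc: "c \<noteq> c'"
    and u: "(c' - c) \<bullet> a = - u * norm (c' - c)" "\<bar>u\<bar> \<le> r"
  shows "line_angle P (perp_line (line_through c c') c) \<le> arcsin (r / norm a) + arcsin (u / norm a)"
proof -
  define \<phi> where "\<phi> = arcsin (r / norm a) + arcsin (u / norm a)"
  have R: "0 < norm a" "r < norm a" using r by auto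
  have ua: "\<bar>u\<bar> \<le> norm a" using u R by auto
  obtain x where x: "x \<noteq> 0" "c \<in> P" "c + x \<in> P"
    "x \<bullet> (c' - c) = - (norm x * norm (c' - c) * sin \<phi>)"
    using outer_tangent_inner[OF P r(1) R(2) cc u(1) ua] unfolding \<phi>_def by blast
  define e where "e = c' - c"
  \<comment> \<open>Of the two directions of the perpendicular, the one on the side of
    \<open>x\<close>.\<close>
  define n where "n = (if 0 \<le> x \<bullet> rot e then rot e else - rot e)"
  have n: "n \<bullet> e = 0" "e \<bullet> n = 0" "n \<bullet> n = e \<bullet> e" "0 \<le> x \<bullet> n" by (auto simp: n_def)
  have e0: "0 < norm e" using cc by (simp add: e_def)
  have nn: "norm n = norm e" using n by (simp add: norm_eq_sqrt_inner)
  then have n0: "n \<noteq> 0" using e0 by auto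
  have "- 1 \<le> u / norm a" "- 1 \<le> r / norm a" "- r / norm a \<le> u / norm a" "u / norm a \<le> r / norm a"
    and ra: "r / norm a \<le> 1 / 2" "0 \<le> r / norm a"
    using u ua r R by (auto simp: field_simps)
  then have "arcsin (- (r / norm a)) \<le> arcsin (u / norm a)"
    "arcsin (u / norm a) \<le> arcsin (r / norm a)" "arcsin (r / norm a) \<le> arcsin (1 / 2)"
    using arcsin_le_arcsin[of "- (r / norm a)" "u / norm a"]
      arcsin_le_arcsin[of "u / norm a" "r / norm a"] arcsin_le_arcsin[of "r / norm a" "1 / 2"]
    by linarith+
  then have \<phi>: "0 \<le> \<phi>" "\<phi> \<le> pi / 2" using ra unfolding \<phi>_def by (auto simp: arcsin_minus)
  then have cos0: "0 \<le> cos \<phi>" by (intro cos_ge_zero) auto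
  have "(x \<bullet> n)\<^sup>2 * (e \<bullet> e) + (x \<bullet> e)\<^sup>2 * (e \<bullet> e) = (e \<bullet> e) * (e \<bullet> e) * (x \<bullet> x)"
    using gram_orthogonal_plane[OF n(2), of x] n by (simp add: inner_commute)
  then have "(e \<bullet> e) * ((x \<bullet> n)\<^sup>2 + (x \<bullet> e)\<^sup>2) = (e \<bullet> e) * ((e \<bullet> e) * (x \<bullet> x))"
    by (simp add: algebra_simps)
  then have "(x \<bullet> n)\<^sup>2 + (x \<bullet> e)\<^sup>2 = (norm e)\<^sup>2 * (norm x)\<^sup>2"
    using e0 by (simp add: power2_norm_eq_inner)
  then have "(x \<bullet> n)\<^sup>2 = (norm x * norm e)\<^sup>2 * (1 - (sin \<phi>)\<^sup>2)"
    using x(4) by (simp add: e_def[symmetric] power_mult_distrib algebra_simps)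
  then have "(x \<bullet> n)\<^sup>2 = (norm x * norm e * cos \<phi>)\<^sup>2"
    by (simp add: cos_squared_eq[symmetric] power_mult_distrib)
  then have xn: "x \<bullet> n = norm x * norm e * cos \<phi>"
    using n cos0 by (subst (asm) power2_eq_iff_nonneg) auto
  have "vec_angle x n = arccos (cos \<phi>)"
    using x(1) e0 by (simp add: vec_angle_def nn xn)
  also have "\<dots> = \<phi>" using \<phi> by (intro arccos_cos) auto
  finally have va: "vec_angle x n = \<phi>" .
  have "line_angle P (perp_line (line_through c c') c) \<le> vec_angle (c + x - c) (c + n - (c + 0))"
    using x n0 n(1) mem_perp_line[of n c' c c] mem_perp_line[of 0 c' c c]
    by (intro line_angle_le) (auto simp: e_def)
  then show ?thesis using va by (simp add: \<phi>_def)
qed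

section \<open>Distances between horoballs\<close>

lemma ball_subset_horoball_at: "ball (c, h / 2) (h / 2) \<subseteq> horoball_at c h"
proof
  fix x assume x: "x \<in> ball (c, h / 2) (h / 2)"
  have "dist (h / 2) (snd x) < h / 2"
    using x dist_snd_le[of "(c, h / 2)" x] by simp
  then have "snd x > 0" by (simp add: dist_real_def abs_if split: if_splits)
  then show "x \<in> horoball_at c h" using x by (simp add: horoball_at_def H3_def)
qed

lemma interior_horoball_at: "interior (horoball_at c h) = ball (c, h / 2) (h / 2)"
proof
  have "interior (horoball_at c h) \<subseteq> interior (cball (c, h / 2) (h / 2))"
    by (rule interior_mono) (simp add: horoball_at_def)
  then show "interior (horoball_at c h) \<subseteq> ball (c, h / 2) (h / 2)" by (simp add: interior_cball)
  show "ball (c, h / 2) (h / 2) \<subseteq> interior (horoball_at c h)"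
    by (intro interior_maximal ball_subset_horoball_at open_ball)
qed

text \<open>The Euclidean centres differ vertically by \<open>(h - k) / 2\<close>, and
  \<open>((h + k) / 2)^2 - ((h - k) / 2)^2 = h * k\<close>.\<close>

lemma dist_center_horoballs:
  fixes c c' :: plane
  assumes "0 < h" "0 < k"
  shows "(h + k) / 2 \<le> dist (c, h / 2) (c', k / 2) \<longleftrightarrow> h * k \<le> (dist c c')\<^sup>2"
    and "dist (c, h / 2) (c', k / 2) \<le> (h + k) / 2 \<longleftrightarrow> (dist c c')\<^sup>2 \<le> h * k"
proof -
  have "(dist (c, h / 2) (c', k / 2))\<^sup>2 = (dist c c')\<^sup>2 + (h - k)\<^sup>2 / 4"
    by (simp add: dist_Pair_Pair dist_real_def power_divide diff_divide_distrib[symmetric])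
  moreover have "((h + k) / 2)\<^sup>2 = h * k + (h - k)\<^sup>2 / 4"
    by (simp add: power2_eq_square field_simps)
  moreover have "(h + k) / 2 \<le> dist (c, h / 2) (c', k / 2)
      \<longleftrightarrow> ((h + k) / 2)\<^sup>2 \<le> (dist (c, h / 2) (c', k / 2))\<^sup>2"
    "dist (c, h / 2) (c', k / 2) \<le> (h + k) / 2
      \<longleftrightarrow> (dist (c, h / 2) (c', k / 2))\<^sup>2 \<le> ((h + k) / 2)\<^sup>2"
    using assms by (auto simp: abs_le_square_iff[symmetric])
  ultimately show "(h + k) / 2 \<le> dist (c, h / 2) (c', k / 2) \<longleftrightarrow> h * k \<le> (dist c c')\<^sup>2"
    "dist (c, h / 2) (c', k / 2) \<le> (h + k) / 2 \<longleftrightarrow> (dist c c')\<^sup>2 \<le> h * k"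
    by auto
qed

lemma disjoint_balls_iff:
  fixes x y :: "'a::real_normed_vector"
  assumes "0 < r" "0 < s"
  shows "ball x r \<inter> ball y s = {} \<longleftrightarrow> r + s \<le> dist x y"
proof
  assume disj: "ball x r \<inter> ball y s = {}"
  show "r + s \<le> dist x y"
  proof (rule ccontr)
    assume "\<not> r + s \<le> dist x y"
    then have n: "norm (y - x) < r + s" by (simp add: dist_norm norm_minus_commute)
    \<comment> \<open>The point dividing the segment from \<open>x\<close> to \<open>y\<close> in
      the ratio \<open>r : s\<close> lies in both balls.\<close>
    define k where "k = r / (r + s)"
    have k: "0 < k" "0 < 1 - k" "k * (r + s) = r" "(1 - k) * (r + s) = s"
      using assms by (auto simp: k_def field_simps)
    have "k * norm (y - x) < k * (r + s)" "(1 - k) * norm (y - x) < (1 - k) * (r + s)"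
      using n k(1,2) by (auto intro!: mult_strict_left_mono)
    moreover have "dist x (x + k *\<^sub>R (y - x)) = k * norm (y - x)"
      using k by (simp add: dist_norm)
    moreover have "dist y (x + k *\<^sub>R (y - x)) = (1 - k) * norm (y - x)"
    proof -
      have "y - (x + k *\<^sub>R (y - x)) = (1 - k) *\<^sub>R (y - x)" by (simp add: algebra_simps)
      then show ?thesis using k by (simp add: dist_norm)
    qed
    ultimately have "x + k *\<^sub>R (y - x) \<in> ball x r \<inter> ball y s" using k by simp
    then show False using disj by blast
  qed
qed (rule disjoint_ballI)

lemma interior_horoballs_disjoint_iff:
  assumes "0 < h" "0 < k"
  shows "interior (horoball_at c h) \<inter> interior (horoball_at c' k) = {} \<longleftrightarrow> h * k \<le> (dist c c')\<^sup>2"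
proof -
  have "interior (horoball_at c h) \<inter> interior (horoball_at c' k) = {}
      \<longleftrightarrow> (h + k) / 2 \<le> dist (c, h / 2) (c', k / 2)"
    unfolding interior_horoball_at using assms by (simp add: disjoint_balls_iff add_divide_distrib)
  then show ?thesis using dist_center_horoballs(1)[OF assms] by simp
qed

lemma tangent_horoballs_dist:
  assumes "0 < h" "0 < k" "tangent_horoballs (horoball_at c h) (horoball_at c' k)"
  shows "(dist c c')\<^sup>2 = h * k"
proof (rule antisym)
  show "h * k \<le> (dist c c')\<^sup>2"
    using assms interior_horoballs_disjoint_iff by (simp add: tangent_horoballs_def)
  obtain z where "z \<in> horoball_at c h" "z \<in> horoball_at c' k"
    using assms by (auto simp: tangent_horoballs_def)
  then have "dist (c, h / 2) (c', k / 2) \<le> h / 2 + k / 2"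
    unfolding horoball_at_def by (intro dist_triangle_le[of _ z]) (simp add: dist_commute)
  then show "(dist c c')\<^sup>2 \<le> h * k"
    using dist_center_horoballs(2)[OF assms(1,2), of c c'] by (simp add: add_divide_distrib)
qed

lemma tangent_full_sized:
  assumes "dist c c' = 1"
  shows "tangent_horoballs (horoball_at c 1) (horoball_at c' 1)"
proof -
  have "(midpoint c c', 1 / 2) \<in> horoball_at c 1 \<inter> horoball_at c' 1"
    using assms by (simp add: horoball_at_def H3_def dist_Pair_Pair dist_midpoint)
  moreover have "interior (horoball_at c 1) \<inter> interior (horoball_at c' 1) = {}"
    using assms by (subst interior_horoballs_disjoint_iff) auto
  ultimately show ?thesis unfolding tangent_horoballs_def by blast
qed

text \<open>A common point projects to a point of the perpendicular within \<open>h / 2\<close> of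
  \<open>b\<close>. Replacing \<open>p\<close> by that point leaves the component along
  \<open>c' - c\<close> unchanged, and Cauchy-Schwarz applies.\<close>

lemma horoball_vertical_plane_bound:
  assumes "horoball_at b h \<inter> vertical_plane (perp_line (line_through c c') p) \<noteq> {}"
  shows "\<bar>(c' - c) \<bullet> (b - p)\<bar> \<le> norm (c' - c) * (h / 2)"
proof -
  obtain z where z: "z \<in> horoball_at b h" "fst z \<in> perp_line (line_through c c') p"
    using assms by (auto simp: vertical_plane_def proj_def)
  have "c \<in> line_through c c'" "c' \<in> line_through c c'"
    by (auto simp: line_through_def hull_inc)
  then have o: "(c' - c) \<bullet> (fst z - p) = 0"
    using z(2) by (auto simp: perp_line_def orthogonal_def inner_commute)
  have "dist b (fst z) \<le> h / 2"
    using z(1) dist_fst_le[of "(b, h / 2)" z] by (simp add: horoball_at_def)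
  then have "norm (c' - c) * norm (b - fst z) \<le> norm (c' - c) * (h / 2)"
    by (intro mult_left_mono) (simp_all add: dist_norm)
  moreover have "(c' - c) \<bullet> (b - p) = (c' - c) \<bullet> (b - fst z)"
    using o by (simp add: inner_diff_right)
  ultimately show ?thesis
    using Cauchy_Schwarz_ineq2[of "c' - c" "b - fst z"] by linarith
qed

section \<open>From the horoball configuration to the inequality for the angles\<close>

lemma full_sized_iff: "0 < h \<Longrightarrow> full_sized (horoball_at c h) \<longleftrightarrow> h = 1"
  by (auto simp: full_sized_def proj_horoball_at cball_eq_cball_iff)

lemma parallel_lines:
  assumes "b' - b = c' - c"
  shows "affine_parallel (line_through b b') (line_through c c')"
proof -
  have "c' = (c - b) + b'" "c = (c - b) + b" using assms by (auto simp: algebra_simps)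
  then have "{c, c'} = (+) (c - b) ` {b, b'}" by (metis image_empty image_insert)
  then show ?thesis
    unfolding affine_parallel_def line_through_def by (metis affine_hull_translation)
qed

lemma outer_tangent_horoball_angle:
  fixes b c c' :: plane
  assumes "0 < h" "h \<le> 1" "c \<noteq> c'" "h \<le> (dist b c)\<^sup>2"
    and "horoball_at b h \<inter> vertical_plane (perp_line (line_through c c') c) \<noteq> {}"
    and "outer_tangent c c' (proj ` horoball_at b h) P"
  defines "u \<equiv> - ((c' - c) \<bullet> (b - c)) / norm (c' - c)"
  shows "line_angle P (perp_line (line_through c c') c)
      \<le> arcsin (h / (2 * dist b c)) + arcsin (u / dist b c)"
    and "\<bar>u\<bar> \<le> h / 2"
proof -
  have e0: "0 < norm (c' - c)" using assms by simp
  show u: "\<bar>u\<bar> \<le> h / 2"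
    using horoball_vertical_plane_bound[OF assms(5)] e0
    by (simp add: u_def abs_divide field_simps)
  \<comment> \<open>With \<open>h \<le> 1\<close> the squared bound on the distance gives
    \<open>h \<le> dist b c\<close>, the condition \<open>2 * r \<le> norm a\<close> of
    \<open>outer_tangent_angle\<close> for \<open>r = h / 2\<close>.\<close>
  have "h\<^sup>2 \<le> h" using assms by (simp add: power2_eq_square mult_left_le)
  then have "h\<^sup>2 \<le> (dist b c)\<^sup>2" using assms by linarith
  then have hd: "h \<le> dist b c" by (rule power2_le_imp_le) simp
  have "line_angle P (perp_line (line_through c c') c)
      \<le> arcsin (h / 2 / norm (b - c)) + arcsin (u / norm (b - c))"
    using assms u hd e0
    by (intro outer_tangent_angle) (auto simp: dist_norm proj_horoball_at u_def)
  then show "line_angle P (perp_line (line_through c c') c)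
      \<le> arcsin (h / (2 * dist b c)) + arcsin (u / dist b c)"
    by (simp add: dist_norm)
qed

theorem lemma3p3:
  fixes C1 C2 B1 B2 :: "space set"
    and L v1 v2 P1 P2 :: "plane set"
    and \<alpha> \<beta> :: real
  assumes "horoball C1" "horoball C2" "full_sized C1" "full_sized C2"
    and "interior C1 \<inter> interior C2 = {}"
    and "horoball B1" "horoball B2" "tangent_horoballs B1 B2"
    and "height B1 \<le> 1" "height B2 \<le> 1"
    and "interior B1 \<inter> (C1 \<union> C2) = {}" "interior B2 \<inter> (C1 \<union> C2) = {}"
    and "L = line_through (center C1) (center C2)"
    and "v1 = perp_line L (center C1)" "v2 = perp_line L (center C2)"
    and "B1 \<inter> vertical_plane v1 \<noteq> {}" "B2 \<inter> vertical_plane v2 \<noteq> {}"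
    and "outer_tangent (center C1) (center C2) (proj ` B1) P1"
    and "on_one_side (proj ` (B1 \<union> B2)) P1"
    and "outer_tangent (center C2) (center C1) (proj ` B2) P2"
    and "on_one_side (proj ` (B1 \<union> B2)) P2"
    and "\<alpha> = line_angle P1 v1" "\<beta> = line_angle P2 v2"
  shows "\<alpha> + \<beta> \<le> pi / 3 \<and>
    (\<alpha> + \<beta> = pi / 3 \<longrightarrow>
      tangent_horoballs C1 C2 \<and>
      full_sized B1 \<and> full_sized B2 \<and>
      tangent_horoballs B1 C1 \<and> tangent_horoballs B2 C2 \<and>
      affine_parallel (line_through (center B1) (center B2)) L)"
proof -
  obtain c1 c2 where C: "C1 = horoball_at c1 1" "C2 = horoball_at c2 1"
    using assms(1-4) unfolding horoball_def by (auto simp: full_sized_iff)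
  obtain b1 h1 b2 h2 where B: "B1 = horoball_at b1 h1" "B2 = horoball_at b2 h2"
    and h0: "0 < h1" "0 < h2"
    using assms(6,7) unfolding horoball_def by blast
  have ctr: "center C1 = c1" "center C2 = c2" "center B1 = b1" "center B2 = b2"
    by (auto simp: B C center_horoball_at h0)
  have h1: "h1 \<le> 1" "h2 \<le> 1"
    using assms(9,10) h0 by (auto simp: B height_horoball_at)
  have disj: "interior A \<inter> interior C = {}" if "interior A \<inter> (C \<union> D) = {}" for A C D :: "space set"
    using that interior_subset by blast
  have "interior B1 \<inter> interior C1 = {}" "interior B2 \<inter> interior C2 = {}"
    using disj[of B1 C1 C2] disj[of B2 C2 C1] assms(11,12) by (auto simp: Un_commute)
  then have d: "1 \<le> (dist c1 c2)\<^sup>2" "h1 \<le> (dist b1 c1)\<^sup>2" "h2 \<le> (dist b2 c2)\<^sup>2"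
    using assms(5) h0 by (auto simp: B C interior_horoballs_disjoint_iff)
  then have d1: "1 \<le> dist c1 c2" by (intro power2_le_imp_le[of 1]) auto
  then have c: "c1 \<noteq> c2" by auto
  have bb: "(dist b1 b2)\<^sup>2 = h1 * h2"
    using assms(8) h0 unfolding B by (intro tangent_horoballs_dist)
  define E where "E = c2 - c1"
  have nE: "norm E = dist c1 c2" by (simp add: E_def dist_norm norm_minus_commute)
  have E0: "0 < norm E" using c by (simp add: E_def)
  have L': "L = line_through c2 c1" "L = line_through c1 c2"
    using assms(13) by (auto simp: ctr line_through_def insert_commute)
  \<comment> \<open>\<open>E\<close> points inwards at \<open>c1\<close> and outwards at
    \<open>c2\<close>; hence the opposite signs in \<open>u\<close> and \<open>w\<close>.\<close>
  define u where "u = - (E \<bullet> (b1 - c1)) / norm E"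
  define w where "w = E \<bullet> (b2 - c2) / norm E"
  have \<alpha>: "\<alpha> \<le> arcsin (h1 / (2 * dist b1 c1)) + arcsin (u / dist b1 c1)" and u: "\<bar>u\<bar> \<le> h1 / 2"
    using outer_tangent_horoball_angle[of h1 c1 c2 b1 P1] h0 h1 c d assms(14,16,18,22)
    unfolding B ctr L'(2) u_def E_def by auto
  have "- ((c1 - c2) \<bullet> (b2 - c2)) / norm (c1 - c2) = w"
    by (simp add: w_def E_def norm_minus_commute inner_diff_left)
  then have \<beta>: "\<beta> \<le> arcsin (h2 / (2 * dist b2 c2)) + arcsin (w / dist b2 c2)" and w: "\<bar>w\<bar> \<le> h2 / 2"
    using outer_tangent_horoball_angle[of h2 c2 c1 b2 P2] h0 h1 c d assms(15,17,20,23)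
    unfolding B ctr L'(1) by auto
  \<comment> \<open>In terms of the roots, the distance conditions become linear in the distances:
    at least \<open>p\<close> and \<open>q\<close> to the full-sized centres, and exactly
    \<open>p * q\<close> between \<open>b1\<close> and \<open>b2\<close>.\<close>
  define p q where "p = sqrt h1" and "q = sqrt h2"
  have pq: "0 < p" "p \<le> 1" "0 < q" "q \<le> 1" "h1 = p\<^sup>2" "h2 = q\<^sup>2"
    using h0 h1 by (auto simp: p_def q_def)
  have rs: "p \<le> dist b1 c1" "q \<le> dist b2 c2"
    using d by (auto simp: p_def q_def intro: real_le_lsqrt)
  have "dist b1 b2 = p * q"
    using bb pq
    by (metis power_mult_distrib power2_eq_iff_nonneg zero_le_dist mult_nonneg_nonneg less_imp_le)
  have nb: "norm (b2 - b1) = p * q"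
    using \<open>dist b1 b2 = p * q\<close> by (simp add: dist_norm norm_minus_commute)
  have scaled: "norm E * u = - (E \<bullet> (b1 - c1))" "norm E * w = E \<bullet> (b2 - c2)"
    "norm E * dist c1 c2 = E \<bullet> E"
    using E0 by (simp_all add: u_def w_def nE[symmetric] power2_norm_eq_inner[symmetric] power2_eq_square)
  have "E \<bullet> (b2 - b1) = E \<bullet> E + E \<bullet> (b2 - c2) - E \<bullet> (b1 - c1)"
    by (simp add: E_def algebra_simps inner_diff_right inner_diff_left)
  also have "\<dots> = norm E * (dist c1 c2 + u + w)"
    by (simp add: distrib_left scaled)
  finally have Eb: "E \<bullet> (b2 - b1) = norm E * (dist c1 c2 + u + w)" .
  then have "norm E * (dist c1 c2 + u + w) \<le> norm E * (p * q)"
    using norm_cauchy_schwarz[of E "b2 - b1"] nb by simp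
  then have uw: "dist c1 c2 + u + w \<le> p * q" using E0 by simp
  note main = angle_sum[OF pq(1-4) rs u[unfolded pq(5,6)] w[unfolded pq(5,6)] d1 uw, folded pq(5,6)]
  have bound: "\<alpha> + \<beta> \<le> pi / 3" using \<alpha> \<beta> main by linarith
  moreover have "tangent_horoballs C1 C2 \<and> full_sized B1 \<and> full_sized B2 \<and>
      tangent_horoballs B1 C1 \<and> tangent_horoballs B2 C2 \<and>
      affine_parallel (line_through (center B1) (center B2)) L" if eq: "\<alpha> + \<beta> = pi / 3"
  proof -
    have e: "p = 1" "q = 1" "dist c1 c2 = 1" "u + w = 0" "dist b1 c1 = 1 \<or> dist b2 c2 = 1"
      using main \<alpha> \<beta> eq by auto
    \<comment> \<open>Both vectors now have norm 1 and their inner product is 1: the equality case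
      of Cauchy-Schwarz. The resulting parallelogram carries the distance 1, known for one of the
      pairs \<open>b1\<close>, \<open>c1\<close> and \<open>b2\<close>, \<open>c2\<close>, over to
      the other.\<close>
    have "(norm (b2 - b1 - E))\<^sup>2 = (norm (b2 - b1))\<^sup>2 - 2 * (E \<bullet> (b2 - b1)) + (norm E)\<^sup>2"
      unfolding power2_norm_eq_inner by (simp add: inner_diff inner_commute)
    also have "\<dots> = 0" using e Eb nb nE by (simp add: add.assoc)
    finally have bE: "b2 - b1 = c2 - c1" by (simp add: E_def)
    then have "b1 - c1 = b2 - c2" by (simp add: algebra_simps)
    then have "dist b1 c1 = dist b2 c2" by (simp add: dist_norm)
    then have "dist b1 c1 = 1" "dist b2 c2 = 1" using e by auto
    then show ?thesis
      using e pq h0 parallel_lines[OF bE] unfolding ctr L'(2)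
      by (auto simp: B C full_sized_iff tangent_full_sized)
  qed
  ultimately show ?thesis by blast
qed

end
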